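(* Let $U:\mathbb{R}^+\to\mathbb{R}^+$ be a measurable function. Then: (i) If $U\in\mathcal{M}$ with $\rho_U=-\tau$ and $r<\tau$, then there exists $x_a>1$ such that for any $c,d$ with $x_a\le c<d<\infty$, $$\lim_{t\to\infty} t^r\sup_{x\in[c,d]}\frac{U(tx)}{U(x)}=0.$$ (ii) If $U\in\mathcal{M}$ with $\rho_U=-\tau$ and $r>\tau$, then there exists $x_b>1$ such that for any $c,d$ with $x_b\le c<d<\infty$, $$\lim_{t\to\infty} t^r\inf_{x\in[c,d]}\frac{U(tx)}{U(x)}=\infty.$$ (iii) If $U\in\mathcal{M}_\infty$ and, for every $s>1$, there is some $M_s>0$ such that $U(x)\ge M_s$ for all $x\in[1,s]$, then for every $r\in\mathbb{R}$ there exists $x_0>1$ such that for any $c,d$ with $x_0\le c<d<\infty$, $$\lim_{t\to\infty} t^r\sup_{x\in[c,d]}\frac{U(tx)}{U(x)}=0.$$ (iv) If $U\in\mathcal{M}_{-\infty}$ and, for every $s>1$, there is some $M_s>0$ such that $U(x)\le M_s$ for all $x\in[1,s]$, then for every $r\in\mathbb{R}$ there exists $x_0>1$ such that for any $c,d$ with $x_0\le c<d<\infty$, $$\lim_{t\to\infty} t^r\inf_{x\in[c,d]}\frac{U(tx)}{U(x)}=\infty.$$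
   Context: $\mathbb{R}^+=(0,\infty)$; functions $U:\mathbb{R}^+\to\mathbb{R}^+$ are thus strictly positive. $\mathcal{M}$ is the class of measurable functions $U:\mathbb{R}^+\to\mathbb{R}^+$ for which there exists $\rho\in\mathbb{R}$ such that for all $\epsilon>0$, $\lim_{x\to\infty}U(x)/x^{\rho+\epsilon}=0$ and $\lim_{x\to\infty}U(x)/x^{\rho-\epsilon}=\infty$. Such a $\rho$ is unique and is denoted $\rho_U$. $\mathcal{M}_\infty$ is the class of measurable functions $U:\mathbb{R}^+\to\mathbb{R}^+$ such that for all $\rho\in\mathbb{R}$, $\lim_{x\to\infty}U(x)/x^{\rho}=0$. $\mathcal{M}_{-\infty}$ is the class of measurable functions $U:\mathbb{R}^+\to\mathbb{R}^+$ such that for all $\rho\in\mathbb{R}$, $\lim_{x\to\infty}U(x)/x^{\rho}=\infty$. *)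

theory Defs
  imports "HOL-Analysis.Analysis"
begin

(* Functions (0,\<infinity>) \<rightarrow> (0,\<infinity>) are represented by total functions real \<Rightarrow> real whose values
   outside {0<..} are irrelevant. Measurability is Lebesgue measurability on {0<..};
   Borel functions are a special case. *)

definition pos_measurable :: "(real \<Rightarrow> real) \<Rightarrow> bool" where
  "pos_measurable U \<longleftrightarrow>
     (\<forall>x>0. U x > 0) \<and> U \<in> borel_measurable (lebesgue_on {0<..})"

definition has_M_index :: "(real \<Rightarrow> real) \<Rightarrow> real \<Rightarrow> bool" where
  "has_M_index U \<rho> \<longleftrightarrow>
     (\<forall>\<epsilon>>0. ((\<lambda>x. U x / x powr (\<rho> + \<epsilon>)) \<longlongrightarrow> 0) at_top \<and>
            filterlim (\<lambda>x. U x / x powr (\<rho> - \<epsilon>)) at_top at_top)"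

definition class_M :: "(real \<Rightarrow> real) set" where
  "class_M = {U. pos_measurable U \<and> (\<exists>\<rho>. has_M_index U \<rho>)}"

definition M_index :: "(real \<Rightarrow> real) \<Rightarrow> real" where
  "M_index U = (THE \<rho>. has_M_index U \<rho>)"

definition class_M_infty :: "(real \<Rightarrow> real) set" where
  "class_M_infty =
     {U. pos_measurable U \<and> (\<forall>\<rho>. ((\<lambda>x. U x / x powr \<rho>) \<longlongrightarrow> 0) at_top)}"

definition class_M_minus_infty :: "(real \<Rightarrow> real) set" where
  "class_M_minus_infty =
     {U. pos_measurable U \<and> (\<forall>\<rho>. filterlim (\<lambda>x. U x / x powr \<rho>) at_top at_top)}"

lemma has_M_index_not_less:
  assumes "has_M_index U \<rho>" "has_M_index U \<sigma>"
  shows "\<not> \<rho> < \<sigma>"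
proof
  assume less: "\<rho> < \<sigma>"
  define e where "e = (\<sigma> - \<rho>) / 2"
  have e: "e > 0" "\<sigma> - e = \<rho> + e"
    using less by (auto simp: e_def field_simps)
  have "((\<lambda>x. U x / x powr (\<rho> + e)) \<longlongrightarrow> 0) at_top"
    using assms(1) e(1) by (auto simp: has_M_index_def)
  moreover have "filterlim (\<lambda>x. U x / x powr (\<rho> + e)) at_top at_top"
    using assms(2) e unfolding has_M_index_def by metis
  ultimately show False
    using not_tendsto_and_filterlim_at_infinity[OF trivial_limit_at_top_linorder]
      filterlim_at_top_imp_at_infinity by blast
qed

lemma has_M_index_unique:
  assumes "has_M_index U \<rho>" "has_M_index U \<sigma>"
  shows "\<rho> = \<sigma>"
  using has_M_index_not_less[OF assms] has_M_index_not_less[OF assms(2,1)] by simp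

lemma M_index_eqI: "has_M_index U \<rho> \<Longrightarrow> M_index U = \<rho>"
  unfolding M_index_def using has_M_index_unique by blast

end

theory Submission
  imports Defs
begin

text \<open>
  Everything rests on the identity
  \<open>t\<^sup>r (U(t x) / U(x)) = (U(t x) / (t x)\<^sup>-\<^sup>r) (x\<^sup>-\<^sup>r / U(x))\<close>,
  which separates the two variables. The first factor depends on \<open>t x\<close> only, and \<open>t x \<ge> t c\<close> on
  \<open>[c, d]\<close>; so a limit of \<open>U(y) / y\<^sup>-\<^sup>r\<close> at infinity is attained uniformly in \<open>x\<close> as \<open>t\<close> grows. The second
  factor does not involve \<open>t\<close>: on \<open>[c, d]\<close> it is bounded above as soon as \<open>U\<close> is bounded away from \<open>0\<close>,
  and bounded away from \<open>0\<close> as soon as \<open>U\<close> is bounded above. This gives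
  \<open>tendsto_powr_times_SUP_ratio\<close> and \<open>filterlim_powr_times_INF_ratio\<close>, and each of the four parts is an
  instance of one of them.

  When \<open>U\<close> has index \<open>-\<tau>\<close>, the limit of \<open>U(y) / y\<^sup>-\<^sup>r\<close> is \<open>0\<close> or \<open>\<infinity>\<close> according to the sign of \<open>\<tau> - r\<close>,
  and the index condition on the opposite side bounds \<open>U\<close> on all compact intervals that lie far enough
  to the right; this is what the thresholds \<open>x\<^sub>a\<close> and \<open>x\<^sub>b\<close> are for. If \<open>U\<close> decays or grows faster than
  every power, no power controls it from the other side, and local bounds on \<open>[1, s]\<close> are assumed instead.
\<close>

section \<open>Powers and dilations\<close>

lemma powr_times_ratio_eq:
  fixes U :: "real \<Rightarrow> real"
  assumes "t > 0" "x > 0"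
  shows "t powr r * (U (t * x) / U x) = U (t * x) / (t * x) powr (- r) * (x powr (- r) / U x)"
proof -
  have "x powr (- r) / (t * x) powr (- r) = t powr r"
    using assms by (simp add: powr_mult powr_minus field_simps)
  then have "t powr r * (U (t * x) / U x) = x powr (- r) / (t * x) powr (- r) * (U (t * x) / U x)"
    by (rule arg_cong2[where f = times, OF sym refl])
  then show ?thesis
    by (simp only: times_divide_times_eq mult.commute)
qed

lemma powr_bounds_on_interval:
  fixes a c d :: real
  assumes "0 < c"
  obtains m M where "0 < m" "0 < M" "\<And>x. x \<in> {c..d} \<Longrightarrow> m \<le> x powr a \<and> x powr a \<le> M"
proof (cases "c \<le> d")
  case True
  have "min (c powr a) (d powr a) \<le> x powr a \<and> x powr a \<le> max (c powr a) (d powr a)"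
    if "x \<in> {c..d}" for x
  proof (cases "a \<ge> 0")
    case True
    then show ?thesis
      using that assms by (auto simp: min_le_iff_disj le_max_iff_disj intro!: powr_mono2)
  next
    case False
    then show ?thesis
      using that assms by (auto simp: min_le_iff_disj le_max_iff_disj intro!: powr_mono2')
  qed
  moreover have "0 < min (c powr a) (d powr a)" "0 < max (c powr a) (d powr a)"
    using assms True by (auto simp: less_max_iff_disj)
  ultimately show thesis
    using that by blast
qed (auto intro: that[of 1 1])

text \<open>
  Multiplying the variable by \<open>t\<close> pushes the whole interval \<open>[c, d]\<close> to infinity, which turns a property
  of all large arguments into one that holds at \<open>t x\<close> uniformly in \<open>x\<close>.
\<close>

lemma eventually_at_top_dilation:
  fixes c :: real
  assumes "eventually P at_top" "0 < c"
  shows "eventually (\<lambda>t::real. 0 < t \<and> (\<forall>x\<ge>c. P (t * x))) at_top"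
proof -
  obtain N where N: "\<And>y. y \<ge> N \<Longrightarrow> P y"
    using assms(1) by (auto simp: eventually_at_top_linorder)
  have "0 < t \<and> (\<forall>x\<ge>c. P (t * x))" if "t \<ge> max 1 (N / c)" for t
  proof (intro conjI allI impI)
    show "0 < t"
      using that by simp
    fix x assume "c \<le> x"
    have "N \<le> t * c"
      using that assms(2) by (simp add: field_simps)
    also have "\<dots> \<le> t * x"
      using \<open>0 < t\<close> \<open>c \<le> x\<close> by simp
    finally show "P (t * x)"
      by (rule N)
  qed
  then show ?thesis
    unfolding eventually_at_top_linorder by blast
qed

section \<open>Uniform limits on compact intervals\<close>

text \<open>
  The factor \<open>x\<^sup>-\<^sup>r / U(x)\<close> is at most \<open>M / K\<close> on \<open>[c, d]\<close>, where \<open>M\<close> bounds \<open>x\<^sup>-\<^sup>r\<close>. Since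
  \<open>U(t x) / (t x)\<^sup>-\<^sup>r\<close> is eventually uniformly below \<open>e K / M\<close>, the product is below \<open>e\<close>.
\<close>

lemma tendsto_powr_times_SUP_ratio:
  fixes U :: "real \<Rightarrow> real"
  assumes pos: "\<And>x. x > 0 \<Longrightarrow> U x > 0"
    and lim: "((\<lambda>x. U x / x powr (- r)) \<longlongrightarrow> 0) at_top"
    and cd: "0 < c" "c \<le> d"
    and K: "0 < K" "\<And>x. x \<in> {c..d} \<Longrightarrow> K \<le> U x"
  shows "((\<lambda>t. ereal (t powr r) * (SUP x\<in>{c..d}. ereal (U (t * x) / U x))) \<longlongrightarrow> 0) at_top"
proof (rule order_tendstoI)
  fix a :: ereal assume "a < 0"
  have "a < ereal (t powr r) * (SUP x\<in>{c..d}. ereal (U (t * x) / U x))" if "t > 0" for t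
  proof -
    have "0 \<le> ereal (U (t * c) / U c)"
      using pos[of "t * c"] pos[of c] that cd by simp
    also have "\<dots> \<le> (SUP x\<in>{c..d}. ereal (U (t * x) / U x))"
      using cd by (intro SUP_upper) auto
    finally show ?thesis
      using \<open>a < 0\<close> by (intro less_le_trans[OF \<open>a < 0\<close>]) simp
  qed
  then show "\<forall>\<^sub>F t in at_top. a < ereal (t powr r) * (SUP x\<in>{c..d}. ereal (U (t * x) / U x))"
    by (rule eventually_mono[OF eventually_gt_at_top])
next
  fix a :: ereal assume "0 < a"
  then obtain e where e: "0 < e" "ereal e < a"
    using ereal_dense2[of 0 a] by (auto simp: zero_ereal_def)
  obtain m M where M: "0 < M" "\<And>x. x \<in> {c..d} \<Longrightarrow> x powr (- r) \<le> M"
    using powr_bounds_on_interval[OF cd(1)] by metis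
  have "eventually (\<lambda>y. U y / y powr (- r) < e * K / M) at_top"
    using order_tendstoD(2)[OF lim] e K(1) M(1) by simp
  from eventually_at_top_dilation[OF this cd(1)]
  show "\<forall>\<^sub>F t in at_top. ereal (t powr r) * (SUP x\<in>{c..d}. ereal (U (t * x) / U x)) < a"
  proof (rule eventually_mono)
    fix t assume t: "0 < t \<and> (\<forall>x\<ge>c. U (t * x) / (t * x) powr (- r) < e * K / M)"
    have "U (t * x) / U x \<le> e / t powr r" if x: "x \<in> {c..d}" for x
    proof -
      have "0 < x"
        using x cd by simp
      have "t powr r * (U (t * x) / U x)
          = U (t * x) / (t * x) powr (- r) * (x powr (- r) / U x)"
        using t \<open>0 < x\<close> by (intro powr_times_ratio_eq) auto
      also have "\<dots> \<le> (e * K / M) * (M / K)"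
      proof (rule mult_mono)
        show "U (t * x) / (t * x) powr (- r) \<le> e * K / M"
          using t x by (simp add: less_imp_le)
        show "x powr (- r) / U x \<le> M / K"
          using x K M by (intro frac_le) auto
      qed (use K M e pos[OF \<open>0 < x\<close>] in auto)
      also have "\<dots> = e"
        using K(1) M(1) by simp
      finally show ?thesis
        using t by (simp add: field_simps)
    qed
    then have "(SUP x\<in>{c..d}. ereal (U (t * x) / U x)) \<le> ereal (e / t powr r)"
      by (intro SUP_least) simp
    then have "ereal (t powr r) * (SUP x\<in>{c..d}. ereal (U (t * x) / U x))
        \<le> ereal (t powr r) * ereal (e / t powr r)"
      by (intro ereal_mult_left_mono) simp_all
    also have "\<dots> = ereal e"
      using t by simp
    finally show "ereal (t powr r) * (SUP x\<in>{c..d}. ereal (U (t * x) / U x)) < a"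
      using e(2) by simp
  qed
qed

text \<open>
  The mirror image: \<open>x\<^sup>-\<^sup>r / U(x)\<close> is at least \<open>m / K\<close> on \<open>[c, d]\<close>, where \<open>m > 0\<close> bounds \<open>x\<^sup>-\<^sup>r\<close> from below.
\<close>

lemma filterlim_powr_times_INF_ratio:
  fixes U :: "real \<Rightarrow> real"
  assumes pos: "\<And>x. x > 0 \<Longrightarrow> U x > 0"
    and lim: "filterlim (\<lambda>x. U x / x powr (- r)) at_top at_top"
    and c: "0 < c"
    and K: "0 < K" "\<And>x. x \<in> {c..d} \<Longrightarrow> U x \<le> K"
  shows "((\<lambda>t. ereal (t powr r) * (INF x\<in>{c..d}. ereal (U (t * x) / U x))) \<longlongrightarrow> \<infinity>) at_top"
  unfolding tendsto_PInfty
proof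
  fix b :: real
  \<comment> \<open>A positive bound strictly above \<open>b\<close>: positivity is needed to multiply the two lower bounds.\<close>
  define B where "B = max b 0 + 1"
  have B: "0 < B" "b < B"
    by (auto simp: B_def)
  obtain m M where m: "0 < m" "\<And>x. x \<in> {c..d} \<Longrightarrow> m \<le> x powr (- r)"
    using powr_bounds_on_interval[OF c] by metis
  have "eventually (\<lambda>y. B * K / m \<le> U y / y powr (- r)) at_top"
    using lim by (simp add: filterlim_at_top)
  from eventually_at_top_dilation[OF this c]
  show "\<forall>\<^sub>F t in at_top. ereal b < ereal (t powr r) * (INF x\<in>{c..d}. ereal (U (t * x) / U x))"
  proof (rule eventually_mono)
    fix t assume t: "0 < t \<and> (\<forall>x\<ge>c. B * K / m \<le> U (t * x) / (t * x) powr (- r))"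
    have "B / t powr r \<le> U (t * x) / U x" if x: "x \<in> {c..d}" for x
    proof -
      have "0 < x"
        using x c by simp
      have "B = (B * K / m) * (m / K)"
        using K(1) m(1) by simp
      also have "\<dots> \<le> U (t * x) / (t * x) powr (- r) * (x powr (- r) / U x)"
      proof (rule mult_mono)
        show "B * K / m \<le> U (t * x) / (t * x) powr (- r)"
          using t x by simp
        show "0 \<le> U (t * x) / (t * x) powr (- r)"
          using t pos[of "t * x"] \<open>0 < x\<close> by simp
        show "m / K \<le> x powr (- r) / U x"
          using x K m pos[OF \<open>0 < x\<close>] by (intro frac_le) auto
      qed (use K m in auto)
      also have "\<dots> = t powr r * (U (t * x) / U x)"
        using t \<open>0 < x\<close> by (intro powr_times_ratio_eq[symmetric]) auto
      finally show ?thesis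
        using t by (simp add: field_simps)
    qed
    then have "ereal (B / t powr r) \<le> (INF x\<in>{c..d}. ereal (U (t * x) / U x))"
      by (intro INF_greatest) simp
    then have "ereal (t powr r) * ereal (B / t powr r)
        \<le> ereal (t powr r) * (INF x\<in>{c..d}. ereal (U (t * x) / U x))"
      by (intro ereal_mult_left_mono) simp_all
    moreover have "ereal (t powr r) * ereal (B / t powr r) = ereal B"
      using t by simp
    ultimately show "ereal b < ereal (t powr r) * (INF x\<in>{c..d}. ereal (U (t * x) / U x))"
      using B(2) by (metis ereal_less(1) less_ereal.simps(1) less_le_trans)
  qed
qed

section \<open>Growth of functions with an index\<close>

lemma has_M_index_M_index:
  assumes "U \<in> class_M"
  shows "has_M_index U (M_index U)"
  using assms M_index_eqI by (fastforce simp: class_M_def)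

lemma has_M_index_powr_above:
  assumes "has_M_index U \<rho>" "\<rho> < \<sigma>"
  shows "((\<lambda>x. U x / x powr \<sigma>) \<longlongrightarrow> 0) at_top"
  using assms(1)[unfolded has_M_index_def, rule_format, of "\<sigma> - \<rho>"] assms(2) by simp

lemma has_M_index_powr_below:
  assumes "has_M_index U \<rho>" "\<sigma> < \<rho>"
  shows "filterlim (\<lambda>x. U x / x powr \<sigma>) at_top at_top"
  using assms(1)[unfolded has_M_index_def, rule_format, of "\<rho> - \<sigma>"] assms(2) by simp

text \<open>
  Beyond some threshold \<open>U(x)\<close> lies between \<open>x\<close> to the powers \<open>\<rho> - 1\<close> and \<open>\<rho> + 1\<close>, and powers
  are bounded and bounded away from \<open>0\<close> on compact intervals.
\<close>

lemma has_M_index_locally_bounded: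
  assumes "has_M_index U \<rho>"
  obtains x0 :: real where "x0 > 1"
    "\<And>c d. x0 \<le> c \<Longrightarrow> \<exists>K>0. \<forall>x\<in>{c..d}. K \<le> U x"
    "\<And>c d. x0 \<le> c \<Longrightarrow> \<exists>K>0. \<forall>x\<in>{c..d}. U x \<le> K"
proof -
  have "eventually (\<lambda>x. U x / x powr (\<rho> + 1) < 1) at_top"
    by (rule order_tendstoD(2)[OF has_M_index_powr_above[OF assms]]) auto
  moreover have "eventually (\<lambda>x. 1 \<le> U x / x powr (\<rho> - 1)) at_top"
    using has_M_index_powr_below[OF assms, of "\<rho> - 1"] by (simp add: filterlim_at_top)
  ultimately have "eventually (\<lambda>x. x powr (\<rho> - 1) \<le> U x \<and> U x \<le> x powr (\<rho> + 1)) at_top"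
    using eventually_gt_at_top[of 0] by eventually_elim (simp add: field_simps)
  then obtain N where N: "\<And>x. x \<ge> N \<Longrightarrow> x powr (\<rho> - 1) \<le> U x \<and> U x \<le> x powr (\<rho> + 1)"
    by (auto simp: eventually_at_top_linorder)
  show thesis
  proof
    show "max 2 N > 1"
      by simp
    fix c d assume c: "max 2 N \<le> c"
    then have "0 < c" and far: "\<And>x. x \<in> {c..d} \<Longrightarrow> N \<le> x"
      by auto
    obtain m where "0 < m" "\<And>x. x \<in> {c..d} \<Longrightarrow> m \<le> x powr (\<rho> - 1)"
      using powr_bounds_on_interval[OF \<open>0 < c\<close>] by metis
    then show "\<exists>K>0. \<forall>x\<in>{c..d}. K \<le> U x"
      using N far by (meson order_trans)
    obtain M where "0 < M" "\<And>x. x \<in> {c..d} \<Longrightarrow> x powr (\<rho> + 1) \<le> M"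
      using powr_bounds_on_interval[OF \<open>0 < c\<close>] by metis
    then show "\<exists>K>0. \<forall>x\<in>{c..d}. U x \<le> K"
      using N far by (meson order_trans)
  qed
qed

section \<open>Ratios of functions in the three classes\<close>

theorem theorem2:
  fixes U :: "real \<Rightarrow> real"
  assumes "pos_measurable U"
  shows
    "(\<forall>\<tau> r. U \<in> class_M \<and> M_index U = - \<tau> \<and> r < \<tau> \<longrightarrow>
        (\<exists>x\<^sub>a>1. \<forall>c d. x\<^sub>a \<le> c \<and> c < d \<longrightarrow>
          ((\<lambda>t. ereal (t powr r) * (SUP x\<in>{c..d}. ereal (U (t * x) / U x))) \<longlongrightarrow> 0) at_top)) \<and>
     (\<forall>\<tau> r. U \<in> class_M \<and> M_index U = - \<tau> \<and> r > \<tau> \<longrightarrow>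
        (\<exists>x\<^sub>b>1. \<forall>c d. x\<^sub>b \<le> c \<and> c < d \<longrightarrow>
          ((\<lambda>t. ereal (t powr r) * (INF x\<in>{c..d}. ereal (U (t * x) / U x))) \<longlongrightarrow> \<infinity>) at_top)) \<and>
     (U \<in> class_M_infty \<and> (\<forall>s>1. \<exists>M>0. \<forall>x\<in>{1..s}. U x \<ge> M) \<longrightarrow>
        (\<forall>r. \<exists>x\<^sub>0>1. \<forall>c d. x\<^sub>0 \<le> c \<and> c < d \<longrightarrow>
          ((\<lambda>t. ereal (t powr r) * (SUP x\<in>{c..d}. ereal (U (t * x) / U x))) \<longlongrightarrow> 0) at_top)) \<and>
     (U \<in> class_M_minus_infty \<and> (\<forall>s>1. \<exists>M>0. \<forall>x\<in>{1..s}. U x \<le> M) \<longrightarrow>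
        (\<forall>r. \<exists>x\<^sub>0>1. \<forall>c d. x\<^sub>0 \<le> c \<and> c < d \<longrightarrow>
          ((\<lambda>t. ereal (t powr r) * (INF x\<in>{c..d}. ereal (U (t * x) / U x))) \<longlongrightarrow> \<infinity>) at_top))"
proof (intro conjI allI impI; elim conjE)
  have pos: "\<And>x. x > 0 \<Longrightarrow> U x > 0"
    using assms by (simp add: pos_measurable_def)
  {
    fix \<tau> r assume U: "U \<in> class_M" "M_index U = - \<tau>" and r: "r < \<tau>"
    have index: "has_M_index U (- \<tau>)"
      using has_M_index_M_index[OF U(1)] U(2) by simp
    obtain x0 :: real where x0: "x0 > 1" "\<And>c d. x0 \<le> c \<Longrightarrow> \<exists>K>0. \<forall>x\<in>{c..d}. K \<le> U x"
      using has_M_index_locally_bounded[OF index] by metis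
    have "((\<lambda>x. U x / x powr (- r)) \<longlongrightarrow> 0) at_top"
      using r by (intro has_M_index_powr_above[OF index]) simp
    note limit = tendsto_powr_times_SUP_ratio[OF pos this]
    show "\<exists>x\<^sub>a>1. \<forall>c d. x\<^sub>a \<le> c \<and> c < d \<longrightarrow>
        ((\<lambda>t. ereal (t powr r) * (SUP x\<in>{c..d}. ereal (U (t * x) / U x))) \<longlongrightarrow> 0) at_top"
    proof (intro exI[of _ x0] conjI allI impI; (elim conjE)?)
      fix c d assume "x0 \<le> c" "c < d"
      with x0 obtain K where "K > 0" "\<forall>x\<in>{c..d}. K \<le> U x"
        by blast
      with \<open>x0 \<le> c\<close> \<open>c < d\<close> x0(1)
      show "((\<lambda>t. ereal (t powr r) * (SUP x\<in>{c..d}. ereal (U (t * x) / U x))) \<longlongrightarrow> 0) at_top"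
        by (intro limit[where K = K]) auto
    qed (rule x0(1))
  next
    fix \<tau> r assume U: "U \<in> class_M" "M_index U = - \<tau>" and r: "r > \<tau>"
    have index: "has_M_index U (- \<tau>)"
      using has_M_index_M_index[OF U(1)] U(2) by simp
    obtain x0 :: real where x0: "x0 > 1" "\<And>c d. x0 \<le> c \<Longrightarrow> \<exists>K>0. \<forall>x\<in>{c..d}. U x \<le> K"
      using has_M_index_locally_bounded[OF index] by metis
    have "filterlim (\<lambda>x. U x / x powr (- r)) at_top at_top"
      using r by (intro has_M_index_powr_below[OF index]) simp
    note limit = filterlim_powr_times_INF_ratio[OF pos this]
    show "\<exists>x\<^sub>b>1. \<forall>c d. x\<^sub>b \<le> c \<and> c < d \<longrightarrow>
        ((\<lambda>t. ereal (t powr r) * (INF x\<in>{c..d}. ereal (U (t * x) / U x))) \<longlongrightarrow> \<infinity>) at_top"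
    proof (intro exI[of _ x0] conjI allI impI; (elim conjE)?)
      fix c d assume "x0 \<le> c" "c < d"
      with x0 obtain K where "K > 0" "\<forall>x\<in>{c..d}. U x \<le> K"
        by blast
      with \<open>x0 \<le> c\<close> x0(1)
      show "((\<lambda>t. ereal (t powr r) * (INF x\<in>{c..d}. ereal (U (t * x) / U x))) \<longlongrightarrow> \<infinity>) at_top"
        by (intro limit[where K = K]) auto
    qed (rule x0(1))
  next
    \<comment> \<open>The local bounds start at \<open>1\<close>, so here every threshold above \<open>1\<close> will do.\<close>
    fix r assume U: "U \<in> class_M_infty" and bound: "\<forall>s>1. \<exists>M>0. \<forall>x\<in>{1..s}. U x \<ge> M"
    have "((\<lambda>x. U x / x powr (- r)) \<longlongrightarrow> 0) at_top"
      using U by (simp add: class_M_infty_def)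
    note limit = tendsto_powr_times_SUP_ratio[OF pos this]
    show "\<exists>x\<^sub>0>1. \<forall>c d. x\<^sub>0 \<le> c \<and> c < d \<longrightarrow>
        ((\<lambda>t. ereal (t powr r) * (SUP x\<in>{c..d}. ereal (U (t * x) / U x))) \<longlongrightarrow> 0) at_top"
    proof (intro exI[of _ 2] conjI allI impI; (elim conjE)?)
      fix c d :: real assume cd: "2 \<le> c" "c < d"
      then obtain K where "K > 0" "\<forall>x\<in>{1..d}. K \<le> U x"
        using bound by (metis less_trans less_le_trans one_less_numeral_iff semiring_norm(76))
      with cd show "((\<lambda>t. ereal (t powr r) * (SUP x\<in>{c..d}. ereal (U (t * x) / U x))) \<longlongrightarrow> 0) at_top"
        by (intro limit[where K = K]) auto
    qed simp
  next
    fix r assume U: "U \<in> class_M_minus_infty" and bound: "\<forall>s>1. \<exists>M>0. \<forall>x\<in>{1..s}. U x \<le> M"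
    have "filterlim (\<lambda>x. U x / x powr (- r)) at_top at_top"
      using U by (simp add: class_M_minus_infty_def)
    note limit = filterlim_powr_times_INF_ratio[OF pos this]
    show "\<exists>x\<^sub>0>1. \<forall>c d. x\<^sub>0 \<le> c \<and> c < d \<longrightarrow>
        ((\<lambda>t. ereal (t powr r) * (INF x\<in>{c..d}. ereal (U (t * x) / U x))) \<longlongrightarrow> \<infinity>) at_top"
    proof (intro exI[of _ 2] conjI allI impI; (elim conjE)?)
      fix c d :: real assume cd: "2 \<le> c" "c < d"
      then obtain K where "K > 0" "\<forall>x\<in>{1..d}. U x \<le> K"
        using bound by (metis less_trans less_le_trans one_less_numeral_iff semiring_norm(76))
      with cd show "((\<lambda>t. ereal (t powr r) * (INF x\<in>{c..d}. ereal (U (t * x) / U x))) \<longlongrightarrow> \<infinity>) at_top"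
        by (intro limit[where K = K]) auto
    qed simp
  }
qed

end
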